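(* Let $K$ be a field and let $X=\{x_1,\dots,x_6\}$, with $X^*$ ordered by the deg-lex order with $x_1<x_2<\cdots<x_6$. Let $R_6\subset K\langle X\rangle$ be the set of initial relations of the Coxeter group of type $E_6$: $$x_i^2-1\ (1\le i\le 6);\qquad x_{i+1}x_ix_{i+1}-x_ix_{i+1}x_i\ (1\le i\le 3);\qquad x_ix_j-x_jx_i\ (1\le j,\ j+1<i\le 4);$$ $$x_5x_i-x_ix_5\ (i\in\{1,2,4\});\qquad x_5x_3x_5-x_3x_5x_3;\qquad x_6x_4x_6-x_4x_6x_4;\qquad x_6x_i-x_ix_6\ (i\in\{1,2,3,5\}).$$ Let $S$ be the union of $R_6$ and the set of the following polynomials: \begin{align*} &x_{i+1,j}x_{i+1}-x_ix_{i+1,j}, && 1\le j<i\le 3;\\ &x'_{5,j}x_5-x_3x'_{5,j}, && 1\le j\le 2;\\ &x'_{5,i}x_{4,i}-x_4x'_{5,i}x_{4,i+1}, && 1\le i\le 3;\\ &x'_{5,i}x_4x_5-x_3x'_{5,i}x_4, && 1\le i\le 3;\\ &x'_{5,i}x_{4,j}x'_{5,j}-x_3x'_{5,i}x_{4,j}x'_{5,j+1}, && 1\le i<j\le 3;\\ &x'_{6,i}x'_{5,i}-x_5x'_{6,i}x'_{5,i+1}, && 1\le i\le 4;\\ &x'_{6,i}x'_{5,j}x_6-x_4x'_{6,i}x'_{5,j}, && 1\le i<j\le 5;\\ &x'_{6,i}x'_{5,j}x_{4,k}x'_{6,k}-x_4x'_{6,i}x'_{5,j}x_{4,k}x'_{6,k+1},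 && 1\le i<j<k\le 4;\\ &x'_{6,1}x'_{5,2}x_{4,3}x_5x'_{6,l}x_5-x_4x'_{6,1}x'_{5,2}x_{4,3}x_5x'_{6,l}, && 1\le l\le 3. \end{align*} Then $S$ is a Gröbner–Shirshov basis of the Coxeter group of type $E_6$; that is, $S$ and $R_6$ generate the same two-sided ideal of $K\langle X\rangle$, and $S$ is a Gröbner–Shirshov basis of this ideal.
   Context: $K\langle X\rangle$ is the free associative unital $K$-algebra on $X$, and $X^*$ is the free monoid on $X$ with identity the empty word $1$; $|w|$ is the length of a word $w$. Deg-lex order: words are compared first by length, and words of equal length are compared lexicographically from the left. For nonzero $f\in K\langle X\rangle$, $\bar f$ is the largest word occurring in $f$; $f$ is monic if the coefficient of $\bar f$ is $1$. Notation for words: for indices with $i>j$, $x_{i,j}=x_ix_{i-1}x_{i-2}\cdots x_j$; $x_{i,i}=x_i$; $x_{i,i+1}=1$. For $i>j+1$, $x'_{i,j}=x_ix_{i-2}x_{i-3}\cdots x_j$ (the letter $x_{i-1}$ is omitted); $x'_{i,i-1}=x_i$; $x'_{i,i}=1$. For example $x'_{6,4}=x_6x_4$, $x'_{6,5}=x_6$, $x'_{6,6}=1$, $x'_{5,3}=x_5x_3$, $x'_{5,4}=x_5$, $x'_{5,5}=1$. Reduction: a reduction by a monic $g$ replaces, in a polynomial, a term $c\,w$ with $w=a\bar g b$ ($c\in K$, $a,b\in X^*$) by $c(w-agb)$. A polynomial reduces to $0$ by a set $S$ of monic polynomials if a finite sequence of reductions by elements of $S$ transforms it to $0$. Compositions: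 for monic $f,g$, $$(f,g)=\{fb-ag\mid a,b\in X^*,\ \bar fb=a\bar g,\ |\bar f|+|\bar g|>|\bar fb|\}\cup\{f-agb\mid a,b\in X^*,\ \bar f=a\bar gb\}.$$ A set $S$ of monic polynomials is a Gröbner–Shirshov basis of the two-sided ideal it generates if for all $f,g\in S$ all elements of $(f,g)$ and $(g,f)$ reduce to $0$ by $S$. (It is not required to be reduced.) A polynomial $u-v$ with $u,v\in X^*$ stands for the relation $u=v$. The relations $R_6$ present the Coxeter group of type $E_6$, with Coxeter–Dynkin diagram the chain $x_6 - x_4 - x_3 - x_2 - x_1$ and $x_5$ joined to $x_3$. *)

theory Defs
  imports
    "HOL-Algebra.Algebraic_Closure_Type"
    "HOL-Library.Poly_Mapping"
    "HOL-Library.List_Lenlexorder"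
begin

text \<open>
  Lists form the free monoid, written additively here because \<^theory>\<open>HOL-Library.Poly_Mapping\<close>
  builds the monoid algebra over an additive monoid of exponents.  With this instance
  \<open>'x list \<Rightarrow>\<^sub>0 'k\<close> is the free associative unital algebra on \<open>'x\<close>.
  The order on words is that of \<^theory>\<open>HOL-Library.List_Lenlexorder\<close>: first by
  length, then lexicographically from the left.
\<close>

instantiation list :: (type) monoid_add
begin

definition zero_list_def: "0 = []"
definition plus_list_def: "u + v = u @ v"

instance
  by standard (simp_all add: zero_list_def plus_list_def)

end

type_synonym ('x, 'k) free_algebra = "'x list \<Rightarrow>\<^sub>0 'k"

definition scalar :: "'k::zero \<Rightarrow> ('x, 'k) free_algebra" where
  "scalar c = Poly_Mapping.single [] c"

definition word :: "'x list \<Rightarrow> ('x, 'k::zero_neq_one) free_algebra" where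
  "word w = Poly_Mapping.single w 1"

definition lead_word :: "('x::linorder, 'k::zero) free_algebra \<Rightarrow> 'x list" where
  "lead_word f = Max (Poly_Mapping.keys f)"

definition monic :: "('x::linorder, 'k::zero_neq_one) free_algebra \<Rightarrow> bool" where
  "monic f \<longleftrightarrow> f \<noteq> 0 \<and> Poly_Mapping.lookup f (lead_word f) = 1"

text \<open>The term \<open>c w\<close> of \<open>f\<close> is replaced by \<open>c (w - a g b)\<close>, where \<open>c\<close> is the full coefficient
  of \<open>w\<close> in \<open>f\<close> and is nonzero.\<close>

inductive reduction ::
  "('x::linorder, 'k::field) free_algebra set \<Rightarrow> ('x, 'k) free_algebra \<Rightarrow> ('x, 'k) free_algebra \<Rightarrow> bool"
  for S where
  "\<lbrakk>g \<in> S; w \<in> Poly_Mapping.keys f; c = Poly_Mapping.lookup f w; w = a @ lead_word g @ b\<rbrakk>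
   \<Longrightarrow> reduction S f (f - scalar c * word w + scalar c * (word w - word a * g * word b))"

definition reduces_to_0 ::
  "('x::linorder, 'k::field) free_algebra set \<Rightarrow> ('x, 'k) free_algebra \<Rightarrow> bool" where
  "reduces_to_0 S f \<longleftrightarrow> (reduction S)\<^sup>*\<^sup>* f 0"

definition compositions ::
  "('x::linorder, 'k::field) free_algebra \<Rightarrow> ('x, 'k) free_algebra \<Rightarrow> ('x, 'k) free_algebra set" where
  "compositions f g =
     {f * word b - word a * g | a b.
        lead_word f @ b = a @ lead_word g \<and>
        length (lead_word f) + length (lead_word g) > length (lead_word f @ b)} \<union>
     {f - word a * g * word b | a b. lead_word f = a @ lead_word g @ b}"

definition ideal_generated :: "'a::ring_1 set \<Rightarrow> 'a set" where
  "ideal_generated S = genideal ring_of_type_algebra S"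

definition groebner_shirshov_basis ::
  "('x::linorder, 'k::field) free_algebra set \<Rightarrow> ('x, 'k) free_algebra set \<Rightarrow> bool" where
  "groebner_shirshov_basis S I \<longleftrightarrow>
     (\<forall>f\<in>S. monic f) \<and> I = ideal_generated S \<and>
     (\<forall>f\<in>S. \<forall>g\<in>S. \<forall>h \<in> compositions f g \<union> compositions g f. reduces_to_0 S h)"

typedef letter = "{1..6::nat}"
  morphisms letter_index gen
  by (rule exI [of _ 1]) simp

instantiation letter :: linorder
begin

definition less_eq_letter_def: "p \<le> q \<longleftrightarrow> letter_index p \<le> letter_index q"
definition less_letter_def: "p < q \<longleftrightarrow> letter_index p < letter_index q"

instance
  by standard (auto simp: less_eq_letter_def less_letter_def letter_index_inject)

end

text \<open>\<open>gen i\<close>, and hence each word below, is meaningful only for indices in \<open>{1..6}\<close>.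
  \<open>xd i j\<close> is \<open>x\<^bsub>i,j\<^esub> = x\<^bsub>i\<^esub> x\<^bsub>i-1\<^esub> \<dots> x\<^bsub>j\<^esub>\<close> for \<open>j \<le> i + 1\<close>; in particular
  \<open>xd i (i + 1) = []\<close>.  \<open>xo i j\<close> is \<open>x'\<^bsub>i,j\<^esub>\<close> for \<open>j \<le> i\<close>, i.e. \<open>x\<^bsub>i,j\<^esub>\<close> with the letter
  \<open>x\<^bsub>i-1\<^esub>\<close> omitted; in particular \<open>xo i (i - 1) = xl i\<close>, whereas \<open>xo i i\<close> is the empty word
  by convention.\<close>

definition xl :: "nat \<Rightarrow> letter list" where
  "xl i = [gen i]"

definition xd :: "nat \<Rightarrow> nat \<Rightarrow> letter list" where
  "xd i j = map gen (rev [j..<Suc i])"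

definition xo :: "nat \<Rightarrow> nat \<Rightarrow> letter list" where
  "xo i j = (if j = i then [] else gen i # map gen (rev [j..<i - 1]))"

definition rel :: "'x list \<Rightarrow> 'x list \<Rightarrow> ('x, 'k::field) free_algebra" where
  "rel u v = word u - word v"

definition R6 :: "(letter, 'k::field) free_algebra set" where
  "R6 =
     {rel (xl i @ xl i) [] | i. 1 \<le> i \<and> i \<le> 6} \<union>
     {rel (xl (i+1) @ xl i @ xl (i+1)) (xl i @ xl (i+1) @ xl i) | i. 1 \<le> i \<and> i \<le> 3} \<union>
     {rel (xl i @ xl j) (xl j @ xl i) | i j. 1 \<le> j \<and> j + 1 < i \<and> i \<le> 4} \<union>
     {rel (xl 5 @ xl i) (xl i @ xl 5) | i. i \<in> {1, 2, 4}} \<union>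
     {rel (xl 5 @ xl 3 @ xl 5) (xl 3 @ xl 5 @ xl 3)} \<union>
     {rel (xl 6 @ xl 4 @ xl 6) (xl 4 @ xl 6 @ xl 4)} \<union>
     {rel (xl 6 @ xl i) (xl i @ xl 6) | i. i \<in> {1, 2, 3, 5}}"

definition S6 :: "(letter, 'k::field) free_algebra set" where
  "S6 = R6 \<union>
     {rel (xd (i+1) j @ xl (i+1)) (xl i @ xd (i+1) j) | i j. 1 \<le> j \<and> j < i \<and> i \<le> 3} \<union>
     {rel (xo 5 j @ xl 5) (xl 3 @ xo 5 j) | j. 1 \<le> j \<and> j \<le> 2} \<union>
     {rel (xo 5 i @ xd 4 i) (xl 4 @ xo 5 i @ xd 4 (i+1)) | i. 1 \<le> i \<and> i \<le> 3} \<union>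
     {rel (xo 5 i @ xl 4 @ xl 5) (xl 3 @ xo 5 i @ xl 4) | i. 1 \<le> i \<and> i \<le> 3} \<union>
     {rel (xo 5 i @ xd 4 j @ xo 5 j) (xl 3 @ xo 5 i @ xd 4 j @ xo 5 (j+1)) | i j.
        1 \<le> i \<and> i < j \<and> j \<le> 3} \<union>
     {rel (xo 6 i @ xo 5 i) (xl 5 @ xo 6 i @ xo 5 (i+1)) | i. 1 \<le> i \<and> i \<le> 4} \<union>
     {rel (xo 6 i @ xo 5 j @ xl 6) (xl 4 @ xo 6 i @ xo 5 j) | i j. 1 \<le> i \<and> i < j \<and> j \<le> 5} \<union>
     {rel (xo 6 i @ xo 5 j @ xd 4 k @ xo 6 k) (xl 4 @ xo 6 i @ xo 5 j @ xd 4 k @ xo 6 (k+1)) | i j k.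
        1 \<le> i \<and> i < j \<and> j < k \<and> k \<le> 4} \<union>
     {rel (xo 6 1 @ xo 5 2 @ xd 4 3 @ xl 5 @ xo 6 l @ xl 5)
          (xl 4 @ xo 6 1 @ xo 5 2 @ xd 4 3 @ xl 5 @ xo 6 l) | l. 1 \<le> l \<and> l \<le> 3}"

end

theory Submission
  imports Defs "HOL-Library.Code_Binary_Nat"
begin

text \<open>
  All elements of \<open>S6\<close> are differences of words, so a composition is the difference of the two
  sides of a critical pair of the word rewriting system \<open>u \<rightarrow> v\<close>, and it reduces to \<open>0\<close> as soon as
  both sides rewrite to a common word. Reading a word from left to right and rewriting at the end of
  the part already read finds such a word for each of the finitely many critical pairs.

  The letters are involutions modulo the ideal of \<open>R6\<close>, so \<open>u - v\<close> lies in this ideal if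
  \<open>u (rev v)\<close> rewrites to \<open>1\<close>. For all but the last three relations of \<open>S6\<close> it does so by the
  relations of \<open>R6\<close> alone; for these three it does so by the other relations of \<open>S6\<close>.
\<close>

subsection \<open>Word rewriting\<close>

inductive rewrite :: "('x list \<times> 'x list) set \<Rightarrow> 'x list \<Rightarrow> 'x list \<Rightarrow> bool" for R where
  "(u, v) \<in> R \<Longrightarrow> rewrite R (a @ u @ b) (a @ v @ b)"

definition joinable :: "('x list \<times> 'x list) set \<Rightarrow> 'x list \<Rightarrow> 'x list \<Rightarrow> bool" where
  "joinable R x y \<longleftrightarrow> (\<exists>z. (rewrite R)\<^sup>*\<^sup>* x z \<and> (rewrite R)\<^sup>*\<^sup>* y z)"

text \<open>An occurrence of a left-hand side is sent to an occurrence of its image. This carries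
  computations with words of numbers over to words of letters along \<open>gen\<close>.\<close>

lemma rewrite_map:
  "rewrite R x y \<Longrightarrow> rewrite (map_prod (map f) (map f) ` R) (map f x) (map f y)"
  by (induction rule: rewrite.induct) (auto intro!: rewrite.intros rev_image_eqI)

lemma rewrites_map:
  "(rewrite R)\<^sup>*\<^sup>* x y \<Longrightarrow> (rewrite (map_prod (map f) (map f) ` R))\<^sup>*\<^sup>* (map f x) (map f y)"
  by (induction rule: rtranclp_induct) (auto intro: rewrite_map rtranclp.rtrancl_into_rtrancl)

lemma joinable_map:
  "joinable R x y \<Longrightarrow> joinable (map_prod (map f) (map f) ` R) (map f x) (map f y)"
  unfolding joinable_def by (blast intro: rewrites_map)

section \<open>Overlaps of words and critical pairs\<close>

fun strip :: "'x list \<Rightarrow> 'x list \<Rightarrow> ('x list \<times> 'x list) option" where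
  "strip (x # s) (y # t) = (if x = y then strip s t else None)"
| "strip [] t = Some ([], t)"
| "strip s [] = Some (s, [])"

lemma strip_eq_SomeD: "strip s t = Some (s', t') \<Longrightarrow> \<exists>m. s = m @ s' \<and> t = m @ t'"
  by (induction s t rule: strip.induct) (auto split: if_splits)

lemma strip_append [simp]: "strip s (s @ t) = Some ([], t)" "strip (s @ t) s = Some (t, [])"
  by (induction s) (auto, cases t, auto)

text \<open>Distinct letters must stay distinct, or a failing comparison could succeed after the
  map. Injectivity is asked only on the letters that occur because \<open>gen\<close> cannot be
  injective on all of \<open>nat\<close>.\<close>

lemma strip_map:
  "inj_on f (set s \<union> set t) \<Longrightarrow> strip (map f s) (map f t) = map_option (map_prod (map f) (map f)) (strip s t)"
  by (induction s t rule: strip.induct) (auto simp: inj_on_def)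

text \<open>The overlaps of \<open>u\<close> with \<open>p\<close> and the occurrences of \<open>p\<close> in \<open>u\<close> are treated together: after
  splitting \<open>u\<close> at position \<open>k\<close>, one of the second part and \<open>p\<close> has to be a prefix of the other.\<close>

fun critical_pairs :: "'x list \<times> 'x list \<Rightarrow> 'x list \<times> 'x list \<Rightarrow> ('x list \<times> 'x list) list" where
  "critical_pairs (u, v) (p, q) =
     concat (map (\<lambda>k. case strip (drop k u) p of None \<Rightarrow> []
       | Some (s, t) \<Rightarrow> [(v @ t, take k u @ q @ s)]) [0..<length u])"

lemma critical_pairs_overlap:
  assumes "u @ b = a @ p" and "length (u @ b) < length u + length p"
  shows "(v @ b, a @ q) \<in> set (critical_pairs (u, v) (p, q))"
proof -
  \<comment> \<open>The length condition says that the two occurrences share a letter, so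
    \<open>length a\<close> is one of the positions where \<open>u\<close> is split.\<close>
  have len: "length a < length u"
    using assms arg_cong[OF assms(1), of length] by simp
  then obtain s where s: "u = a @ s"
    using assms(1) by (metis append_eq_append_conv_if nat_less_le append_take_drop_id)
  with assms(1) have "p = s @ b" by simp
  with s len show ?thesis
    by (auto intro!: bexI[of _ "length a"])
qed

text \<open>With \<open>p\<close> nonempty, \<open>length a\<close> is a valid splitting position
  even if \<open>b\<close> is empty.\<close>

lemma critical_pairs_inclusion:
  assumes "p \<noteq> []"
  shows "(v, a @ q @ b) \<in> set (critical_pairs (a @ p @ b, v) (p, q))"
  using assms by (auto intro!: bexI[of _ "length a"])

lemma critical_pairs_map:
  assumes "inj_on f (set u \<union> set p)"
  shows "critical_pairs (map f u, map f v) (map f p, map f q) =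
    map (map_prod (map f) (map f)) (critical_pairs (u, v) (p, q))"
proof -
  have "strip (drop k (map f u)) (map f p) = map_option (map_prod (map f) (map f)) (strip (drop k u) p)" for k
    unfolding drop_map
    by (rule strip_map, rule inj_on_subset[OF assms]) (use set_drop_subset in fastforce)
  then show ?thesis
    by (auto simp: map_concat take_map intro!: arg_cong[of _ _ concat] split: option.split)
qed

section \<open>Normal forms computed with a stack\<close>

text \<open>The pattern \<open>Some ([], w')\<close> accepts a left-hand side only if it is used up;
  a success of \<open>strip\<close> because \<open>w\<close> is too short is rejected.\<close>

fun redex :: "('x list \<times> 'x list) list \<Rightarrow> 'x list \<Rightarrow> ('x list \<times> 'x list) option" where
  "redex [] w = None"
| "redex ((u, v) # R) w = (case strip u w of Some ([], w') \<Rightarrow> Some (w', v) | _ \<Rightarrow> redex R w)"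

lemma redex_eq_SomeD: "redex R w = Some (w', v) \<Longrightarrow> \<exists>u. (u, v) \<in> set R \<and> w = u @ w'"
proof (induction R w rule: redex.induct)
  case (2 u' v' R w)
  show ?case
  proof (cases "\<exists>t. strip u' w = Some ([], t)")
    case True
    with "2.prems" show ?thesis by (auto dest!: strip_eq_SomeD)
  next
    case False
    then have "redex ((u', v') # R) w = redex R w"
      by (auto split: option.split list.split)
    with "2.prems" have "redex R w = Some (w', v)" by simp
    moreover have "\<exists>u. (u, v) \<in> set R \<and> w = u @ w'" if "redex R w = Some (w', v)"
      using "2.IH" False that by (cases "strip u' w") (auto, metis neq_Nil_conv)
    ultimately show ?thesis by auto
  qed
qed simp

definition rule_table :: "('x list \<times> 'x list) list \<Rightarrow> ('x \<times> ('x list \<times> 'x list) list) list" where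
  "rule_table R = map (\<lambda>x. (x, map (\<lambda>(u, v). (tl (rev u), v)) (filter (\<lambda>(u, v). u \<noteq> [] \<and> last u = x) R)))
     (remdups (map (last \<circ> fst) R))"

fun rules_at :: "('x \<times> 'b list) list \<Rightarrow> 'x \<Rightarrow> 'b list" where
  "rules_at [] x = []"
| "rules_at ((y, R) # T) x = (if x = y then R else rules_at T x)"

lemma rules_at_subset: "r \<in> set (rules_at T x) \<Longrightarrow> \<exists>R. (x, R) \<in> set T \<and> r \<in> set R"
  by (induction T x rule: rules_at.induct) (auto split: if_splits)

lemma rules_at_rule_table:
  assumes "(u, v) \<in> set (rules_at (rule_table R) x)"
  shows "(rev u @ [x], v) \<in> set R"
proof -
  from rules_at_subset[OF assms] obtain w where w: "(w, v) \<in> set R" "w \<noteq> []" "last w = x" "u = tl (rev w)"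
    unfolding rule_table_def by force
  from w(2-4) have "rev u @ [x] = w"
    by (cases w rule: rev_cases) auto
  with w(1) show ?thesis by simp
qed

text \<open>The stack \<open>st\<close> is the reversal of the part already read. This part is irreducible, so a redex
  can only end at the next letter \<open>x\<close>; this is why the rules are tabulated by the last letter of the
  left-hand side, with the rest of it reversed.\<close>

partial_function (option) normalize ::
  "('x \<times> ('x list \<times> 'x list) list) list \<Rightarrow> 'x list \<Rightarrow> 'x list \<Rightarrow> 'x list option" where
  "normalize T st ws = (case ws of [] \<Rightarrow> Some (rev st) | x # ws' \<Rightarrow>
     (case redex (rules_at T x) st of None \<Rightarrow> normalize T (x # st) ws'
       | Some (st', v) \<Rightarrow> normalize T st' (v @ ws')))"

text \<open>Fixpoint induction over runs that end. The invariant is the word spelled by the stack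
  and the remaining input: pushing a letter leaves it unchanged, and contracting a redex is one
  rewriting step.\<close>

lemma normalize_sound:
  assumes "normalize (rule_table R) st ws = Some z"
  shows "(rewrite (set R))\<^sup>*\<^sup>* (rev st @ ws) z"
proof -
  have "T = rule_table R \<longrightarrow> (rewrite (set R))\<^sup>*\<^sup>* (rev st @ ws) z"
    if "normalize T st ws = Some z" for T
    using that
  proof (induction T st ws z rule: normalize.raw_induct[rotated, consumes 1])
    case (1 nf T st ws z)
    show ?case
    proof
      assume T: "T = rule_table R"
      show "(rewrite (set R))\<^sup>*\<^sup>* (rev st @ ws) z"
      proof (cases ws)
        case Nil
        with 1(2) show ?thesis by simp
      next
        case (Cons x ws')
        show ?thesis
        proof (cases "redex (rules_at T x) st")
          case None
          then have "nf T (x # st) ws' = Some z"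
            using 1(2) Cons by simp
          from 1(1)[OF this] T Cons show ?thesis by simp
        next
          case (Some p)
          then obtain st' v where p: "redex (rules_at T x) st = Some (st', v)" by (cases p) auto
          then obtain u where u: "(u, v) \<in> set (rules_at T x)" "st = u @ st'"
            using redex_eq_SomeD by metis
          have "rewrite (set R) (rev st' @ (rev u @ [x]) @ ws') (rev st' @ v @ ws')"
            using u(1) T by (intro rewrite.intros rules_at_rule_table) simp
          moreover have "nf T st' (v @ ws') = Some z"
            using 1(2) Cons p by simp
          from 1(1)[OF this] T have "(rewrite (set R))\<^sup>*\<^sup>* (rev st' @ v @ ws') z" by simp
          ultimately show ?thesis
            using Cons u(2) by (simp add: converse_rtranclp_into_rtranclp)
        qed
      qed
    qed
  qed
  with assms show ?thesis by simp
qed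

lemma normalize_word_sound:
  "normalize (rule_table R) [] w = Some z \<Longrightarrow> (rewrite (set R))\<^sup>*\<^sup>* w z"
  using normalize_sound[of R "[]"] by simp

text \<open>The first case keeps \<open>None = None\<close> from counting as agreement on a common
  word.\<close>

definition joins :: "('x \<times> ('x list \<times> 'x list) list) list \<Rightarrow> 'x list \<times> 'x list \<Rightarrow> bool" where
  "joins T = (\<lambda>(x, y). case normalize T [] x of None \<Rightarrow> False
     | Some z \<Rightarrow> normalize T [] y = Some z)"

lemma joins_sound:
  assumes "joins (rule_table R) (x, y)"
  shows "joinable (set R) x y"
proof -
  from assms obtain z where "normalize (rule_table R) [] x = Some z" "normalize (rule_table R) [] y = Some z"
    by (auto simp: joins_def split: option.splits)
  then show ?thesis
    unfolding joinable_def by (intro exI[of _ z] conjI normalize_word_sound)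
qed

text \<open>Code equations without \<open>if\<close> and \<open>case\<close>: the simplifier normalizes an instance of such a
  combinator again after every step inside it, including the whole rule table.\<close>

definition rules_at_cont :: "bool \<Rightarrow> 'b list \<Rightarrow> ('x \<times> 'b list) list \<Rightarrow> 'x \<Rightarrow> 'b list" where
  "rules_at_cont b R T x = (if b then R else rules_at T x)"

definition redex_cont ::
  "('x list \<times> 'x list) option \<Rightarrow> 'x list \<Rightarrow> ('x list \<times> 'x list) list \<Rightarrow> 'x list \<Rightarrow> ('x list \<times> 'x list) option" where
  "redex_cont r v R w = (case r of Some ([], w') \<Rightarrow> Some (w', v) | _ \<Rightarrow> redex R w)"

definition normalize_cont :: "('x list \<times> 'x list) option \<Rightarrow>
    ('x \<times> ('x list \<times> 'x list) list) list \<Rightarrow> 'x \<Rightarrow> 'x list \<Rightarrow> 'x list \<Rightarrow> 'x list option" where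
  "normalize_cont r T x st ws = (case r of None \<Rightarrow> normalize T (x # st) ws
     | Some (st', v) \<Rightarrow> normalize T st' (v @ ws))"

definition joins_cont :: "'x list option \<Rightarrow> ('x \<times> ('x list \<times> 'x list) list) list \<Rightarrow> 'x list \<Rightarrow> bool" where
  "joins_cont r T y = (case r of None \<Rightarrow> False | Some z \<Rightarrow> normalize T [] y = Some z)"

lemma rules_at_code [code]:
  "rules_at [] x = []"
  "rules_at ((y, R) # T) x = rules_at_cont (x = y) R T x"
  by (simp_all add: rules_at_cont_def)

lemma rules_at_cont_code [code]:
  "rules_at_cont True R T x = R"
  "rules_at_cont False R T x = rules_at T x"
  by (simp_all add: rules_at_cont_def)

lemma redex_code [code]:
  "redex [] w = None"
  "redex ((u, v) # R) w = redex_cont (strip u w) v R w"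
  by (simp_all add: redex_cont_def)

lemma redex_cont_code [code]:
  "redex_cont None v R w = redex R w"
  "redex_cont (Some ([], w')) v R w = Some (w', v)"
  "redex_cont (Some (y # ys, w')) v R w = redex R w"
  by (simp_all add: redex_cont_def)

lemma normalize_code [code]:
  "normalize T st [] = Some (rev st)"
  "normalize T st (x # ws) = normalize_cont (redex (rules_at T x) st) T x st ws"
  by (subst normalize.simps; simp add: normalize_cont_def)+

lemma normalize_cont_code [code]:
  "normalize_cont None T x st ws = normalize T (x # st) ws"
  "normalize_cont (Some (st', v)) T x st ws = normalize T st' (v @ ws)"
  by (simp_all add: normalize_cont_def)

lemma joins_code [code]: "joins T (x, y) = joins_cont (normalize T [] x) T y"
  by (simp add: joins_def joins_cont_def)

lemma joins_cont_code [code]: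
  "joins_cont None T y = False"
  "joins_cont (Some z) T y = (normalize T [] y = Some z)"
  by (simp_all add: joins_cont_def)

subsection \<open>Binomials in the free algebra\<close>

lemma word_mult [simp]: "word a * word b = (word (a @ b) :: ('x, 'k::field) free_algebra)"
  by (simp add: word_def mult_single plus_list_def)

lemma word_Nil [simp]: "word [] = (1 :: ('x, 'k::field) free_algebra)"
  by (simp add: word_def flip: zero_list_def single_one)

lemma lookup_word: "Poly_Mapping.lookup (word u) w = (if u = w then 1 else 0)"
  by (simp add: word_def lookup_single when_def)

lemma lookup_rel:
  "u \<noteq> v \<Longrightarrow> Poly_Mapping.lookup (rel u v :: ('x, 'k::field) free_algebra) u = 1"
  "u \<noteq> v \<Longrightarrow> Poly_Mapping.lookup (rel u v :: ('x, 'k::field) free_algebra) v = - 1"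
  by (simp_all add: rel_def lookup_minus lookup_word)

lemma keys_rel:
  assumes "u \<noteq> v"
  shows "Poly_Mapping.keys (rel u v :: ('x, 'k::field) free_algebra) = {u, v}"
  using assms by (auto simp: rel_def in_keys_iff lookup_minus lookup_word split: if_splits)

lemma lead_word_rel:
  "v < u \<Longrightarrow> lead_word (rel u v :: ('x::linorder, 'k::field) free_algebra) = u"
  by (simp add: lead_word_def keys_rel)

lemma monic_rel:
  assumes "v < u"
  shows "monic (rel u v :: ('x::linorder, 'k::field) free_algebra)"
proof -
  have "Poly_Mapping.lookup (rel u v :: ('x, 'k) free_algebra) u = 1"
    using assms by (simp add: lookup_rel)
  then show ?thesis
    using assms by (auto simp: monic_def lead_word_rel)
qed

abbreviation rels :: "('x list \<times> 'x list) set \<Rightarrow> ('x, 'k::field) free_algebra set" where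
  "rels R \<equiv> (\<lambda>(u, v). rel u v) ` R"

lemma scalar_1 [simp]: "scalar 1 = 1" and scalar_minus_1 [simp]: "scalar (- 1 :: 'k::field) = - 1"
  by (simp_all add: scalar_def flip: zero_list_def single_one single_uminus)

text \<open>By \<open>x \<noteq> y\<close>, the word \<open>x\<close> occurs with full coefficient
  1, so that reducing this term replaces just the left word.\<close>

lemma reduction_rel_left:
  assumes less: "\<And>u v. (u, v) \<in> R \<Longrightarrow> v < u" and "rewrite R x x'" and "x \<noteq> y"
  shows "reduction (rels R) (rel x y :: ('x::linorder, 'k::field) free_algebra) (rel x' y)"
proof -
  from assms(2) obtain u v a b where R: "(u, v) \<in> R" and x: "x = a @ u @ b" "x' = a @ v @ b"
    by (auto elim: rewrite.cases)
  have "reduction (rels R) (rel x y :: ('x, 'k) free_algebra)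
     (rel x y - scalar 1 * word x + scalar 1 * (word x - word a * rel u v * word b))"
    by (rule reduction.intros)
      (use assms(3) R x less[OF R] in \<open>auto simp: keys_rel lookup_rel lead_word_rel\<close>)
  then show ?thesis
    by (simp add: x rel_def algebra_simps)
qed

lemma reduction_rel_right:
  assumes less: "\<And>u v. (u, v) \<in> R \<Longrightarrow> v < u" and "rewrite R y y'" and "x \<noteq> y"
  shows "reduction (rels R) (rel x y :: ('x::linorder, 'k::field) free_algebra) (rel x y')"
proof -
  from assms(2) obtain u v a b where R: "(u, v) \<in> R" and y: "y = a @ u @ b" "y' = a @ v @ b"
    by (auto elim: rewrite.cases)
  have "reduction (rels R) (rel x y :: ('x, 'k) free_algebra)
     (rel x y - scalar (- 1) * word y + scalar (- 1) * (word y - word a * rel u v * word b))"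
    by (rule reduction.intros)
      (use assms(3) R y less[OF R] in \<open>auto simp: keys_rel lookup_rel lead_word_rel\<close>)
  then show ?thesis
    by (simp add: y rel_def algebra_simps)
qed

text \<open>The reductions first bring \<open>x\<close> to the common word \<open>z\<close>, then
  \<open>y\<close>. If both words agree earlier, the polynomial is already 0 and the sequence stops
  there.\<close>

lemma reduces_to_0_rel:
  assumes less: "\<And>u v. (u, v) \<in> R \<Longrightarrow> v < u" and "joinable R x y"
  shows "reduces_to_0 (rels R) (rel x y :: ('x::linorder, 'k::field) free_algebra)"
proof -
  from assms(2) obtain z where x: "(rewrite R)\<^sup>*\<^sup>* x z" and y: "(rewrite R)\<^sup>*\<^sup>* y z"
    by (auto simp: joinable_def)
  have eq: "reduces_to_0 (rels R) (rel w w :: ('x, 'k) free_algebra)" for w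
    by (simp add: rel_def reduces_to_0_def)
  have first: "reduces_to_0 (rels R) f" if "reduction (rels R) f g" "reduces_to_0 (rels R) g"
    for f g :: "('x, 'k) free_algebra"
    using that unfolding reduces_to_0_def by (rule converse_rtranclp_into_rtranclp)
  from y have *: "reduces_to_0 (rels R) (rel z y :: ('x, 'k) free_algebra)"
  proof (induction rule: converse_rtranclp_induct)
    case (step y y')
    then show ?case
      by (cases "z = y") (blast intro: eq less first reduction_rel_right)+
  qed (rule eq)
  from x show ?thesis
  proof (induction rule: converse_rtranclp_induct)
    case (step x x')
    then show ?case
      by (cases "x = y") (blast intro: eq less first reduction_rel_left)+
  qed (rule *)
qed

text \<open>The leading words cancel: an overlap leaves \<open>a @ q\<close> minus
  \<open>v @ b\<close>, an inclusion \<open>a @ q @ b\<close> minus \<open>v\<close>. Hence the pair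
  appears in reverse order in \<open>rel y x\<close>.\<close>

lemma compositions_rel:
  assumes "v < u" and "q < p" and "h \<in> compositions (rel u v) (rel p q :: ('x::linorder, 'k::field) free_algebra)"
  shows "\<exists>(x, y) \<in> set (critical_pairs (u, v) (p, q)). h = rel y x"
proof -
  from assms consider
      (overlap) a b where "u @ b = a @ p" "length (u @ b) < length u + length p"
        "h = rel u v * word b - word a * rel p q"
    | (inclusion) a b where "u = a @ p @ b" "h = rel u v - word a * rel p q * word b"
    unfolding compositions_def lead_word_rel[OF assms(1)] lead_word_rel[OF assms(2)] by blast
  then show ?thesis
  proof cases
    case overlap
    then have "h = rel (a @ q) (v @ b)"
      by (simp add: rel_def algebra_simps)
    then show ?thesis
      using critical_pairs_overlap[OF overlap(1,2)] by blast
  next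
    case inclusion
    have "p \<noteq> []" using assms(2) by auto
    moreover have "h = rel (a @ q @ b) v"
      using inclusion by (simp add: rel_def algebra_simps)
    ultimately show ?thesis
      using critical_pairs_inclusion[of p v a q b] inclusion(1) by blast
  qed
qed

text \<open>The premise \<open>join\<close> ranges over ordered pairs of rules, which covers the
  compositions in both orders.\<close>

theorem groebner_shirshov_basis_rels:
  assumes less: "\<And>u v. (u, v) \<in> R \<Longrightarrow> v < u"
    and join: "\<And>r s x y. r \<in> R \<Longrightarrow> s \<in> R \<Longrightarrow> (x, y) \<in> set (critical_pairs r s) \<Longrightarrow> joinable R x y"
  shows "groebner_shirshov_basis (rels R :: ('x::linorder, 'k::field) free_algebra set) (ideal_generated (rels R))"
proof -
  have "reduces_to_0 (rels R) h"
    if r: "(u, v) \<in> R" and s: "(p, q) \<in> R" and h: "h \<in> compositions (rel u v) (rel p q)"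
    for u v p q and h :: "('x, 'k) free_algebra"
  proof -
    obtain x y where xy: "(x, y) \<in> set (critical_pairs (u, v) (p, q))" "h = rel y x"
      using compositions_rel[OF less[OF r] less[OF s] h] by blast
    have "joinable R y x"
      using join[OF r s xy(1)] by (auto simp: joinable_def)
    then show ?thesis
      using xy(2) reduces_to_0_rel[OF less] by blast
  qed
  then show ?thesis
    using less by (auto simp: groebner_shirshov_basis_def intro: monic_rel)
qed

subsection \<open>Congruence of words modulo an ideal\<close>

lemma ring_ring_of_type_algebra: "ring (ring_of_type_algebra :: 'a::ring_1 ring)"
proof -
  have "\<exists>y. y + x = 0" for x :: 'a
    using left_minus by blast
  moreover have "\<exists>y. x + y = 0" for x :: 'a
    using right_minus by blast
  ultimately show ?thesis
    by unfold_locales (auto simp: ring_of_type_algebra_def algebra_simps Units_def)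
qed

lemma ideal_ideal_generated: "ideal (ideal_generated A) (ring_of_type_algebra :: 'a::ring_1 ring)"
  unfolding ideal_generated_def
  by (rule ring.genideal_ideal[OF ring_ring_of_type_algebra]) (simp add: ring_of_type_algebra_def)

lemma ideal_generated_superset: "A \<subseteq> ideal_generated (A :: 'a::ring_1 set)"
  unfolding ideal_generated_def
  by (rule ring.genideal_self[OF ring_ring_of_type_algebra]) (simp add: ring_of_type_algebra_def)

lemma ideal_generated_minimal:
  "A \<subseteq> ideal_generated B \<Longrightarrow> ideal_generated A \<subseteq> ideal_generated (B :: 'a::ring_1 set)"
  unfolding ideal_generated_def[of A]
  by (rule ring.genideal_minimal[OF ring_ring_of_type_algebra ideal_ideal_generated])

lemma ideal_generated_closed:
  fixes x y :: "'a::ring_1"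
  assumes "x \<in> ideal_generated A"
  shows "y \<in> ideal_generated A \<Longrightarrow> x + y \<in> ideal_generated A"
    and "y * x \<in> ideal_generated A" and "x * y \<in> ideal_generated A"
proof -
  interpret ideal "ideal_generated A" "ring_of_type_algebra :: 'a ring"
    by (rule ideal_ideal_generated)
  show "y \<in> ideal_generated A \<Longrightarrow> x + y \<in> ideal_generated A"
    using additive_subgroup.a_closed[OF is_additive_subgroup, of x y] assms by (simp add: ring_of_type_algebra_def)
  show "y * x \<in> ideal_generated A" "x * y \<in> ideal_generated A"
    using I_l_closed[of x y] I_r_closed[of x y] assms by (simp_all add: ring_of_type_algebra_def)
qed

lemma rel_self_in_ideal: "rel u u \<in> ideal_generated A"
proof -
  interpret ideal "ideal_generated A" "ring_of_type_algebra :: ('a, 'b) free_algebra ring"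
    by (rule ideal_ideal_generated)
  show ?thesis
    using additive_subgroup.zero_closed[OF is_additive_subgroup] by (simp add: rel_def ring_of_type_algebra_def)
qed

lemma rel_trans_in_ideal:
  "rel u v \<in> ideal_generated A \<Longrightarrow> rel v w \<in> ideal_generated A \<Longrightarrow> rel u w \<in> ideal_generated A"
  using ideal_generated_closed(1)[of "rel u v" A "rel v w"] by (simp add: rel_def)

lemma rel_sym_in_ideal: "rel u v \<in> ideal_generated A \<Longrightarrow> rel v u \<in> ideal_generated A"
  using ideal_generated_closed(2)[of "rel u v" A "- 1"] by (simp add: rel_def)

lemma rel_context_in_ideal:
  assumes "rel u v \<in> ideal_generated A"
  shows "rel (a @ u @ b) (a @ v @ b) \<in> ideal_generated A"
proof -
  have "word a * (rel u v * word b) \<in> ideal_generated A"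
    by (intro ideal_generated_closed assms)
  then show ?thesis by (simp add: rel_def algebra_simps)
qed

lemma rewrites_in_ideal:
  assumes "rels R \<subseteq> ideal_generated A" and "(rewrite R)\<^sup>*\<^sup>* x y"
  shows "rel x y \<in> ideal_generated A"
  using assms(2)
proof (induction rule: rtranclp_induct)
  case (step y z)
  from step(2) have "rel y z \<in> ideal_generated A"
    using assms(1) by cases (auto intro!: rel_context_in_ideal)
  with step(3) show ?case by (rule rel_trans_in_ideal)
qed (rule rel_self_in_ideal)

text \<open>As letters are involutions modulo the ideal, \<open>rev v\<close> is inverse to
  \<open>v\<close>: the two innermost letters cancel, pair after pair.\<close>

lemma rel_rev_self_in_ideal:
  assumes "\<And>x. rel [x, x] [] \<in> ideal_generated A"
  shows "rel (rev v @ v) [] \<in> ideal_generated A"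
proof (induction v)
  case (Cons x v)
  have "rel (rev v @ [x, x] @ v) (rev v @ [] @ v) \<in> ideal_generated A"
    by (rule rel_context_in_ideal[OF assms])
  then show ?case
    using Cons by (auto intro: rel_trans_in_ideal)
qed (simp add: rel_self_in_ideal)

text \<open>With \<open>rev v\<close> as inverse of \<open>v\<close>, the word \<open>u\<close> is
  congruent to \<open>u @ rev v @ v\<close>, and this to \<open>v\<close>.\<close>

lemma rel_in_ideal_if_quotient:
  assumes "\<And>x. rel [x, x] [] \<in> ideal_generated A" and "rel (u @ rev v) [] \<in> ideal_generated A"
  shows "rel u v \<in> ideal_generated A"
proof (rule rel_trans_in_ideal)
  show "rel u (u @ rev v @ v) \<in> ideal_generated A"
    using rel_context_in_ideal[OF rel_rev_self_in_ideal[OF assms(1)], of u v "[]"]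
    by (auto intro: rel_sym_in_ideal)
  show "rel (u @ rev v @ v) v \<in> ideal_generated A"
    using rel_context_in_ideal[OF assms(2), of "[]" v] by simp
qed

subsection \<open>The rules of \<open>E\<^sub>6\<close>\<close>

text \<open>Lists of natural numbers represent the words here: unlike \<open>letter\<close>, their equality is executable.\<close>

definition descending :: "nat \<Rightarrow> nat \<Rightarrow> nat list" where
  "descending i j = rev [j..<Suc i]"

definition omitting :: "nat \<Rightarrow> nat \<Rightarrow> nat list" where
  "omitting i j = (if j = i then [] else i # rev [j..<i - 1])"

text \<open>Upper bounds are exclusive: the range \<open>[1..<i - 1]\<close> for \<open>j\<close>
  expresses \<open>j + 1 < i\<close> and is empty for \<open>i \<le> 2\<close>.\<close>

definition coxeter_rules :: "(nat list \<times> nat list) list" where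
  "coxeter_rules =
    [([i, i], []). i \<leftarrow> [1..<7]] @
    [([i + 1, i, i + 1], [i, i + 1, i]). i \<leftarrow> [1..<4]] @
    [([i, j], [j, i]). i \<leftarrow> [1..<5], j \<leftarrow> [1..<i - 1]] @
    [([5, i], [i, 5]). i \<leftarrow> [1, 2, 4]] @
    [([5, 3, 5], [3, 5, 3])] @
    [([6, 4, 6], [4, 6, 4])] @
    [([6, i], [i, 6]). i \<leftarrow> [1, 2, 3, 5]]"

definition derived_rules :: "(nat list \<times> nat list) list" where
  "derived_rules =
    [(descending (i + 1) j @ [i + 1], i # descending (i + 1) j). i \<leftarrow> [1..<4], j \<leftarrow> [1..<i]] @
    [(omitting 5 j @ [5], 3 # omitting 5 j). j \<leftarrow> [1..<3]] @
    [(omitting 5 i @ descending 4 i, 4 # omitting 5 i @ descending 4 (i + 1)). i \<leftarrow> [1..<4]] @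
    [(omitting 5 i @ [4, 5], 3 # omitting 5 i @ [4]). i \<leftarrow> [1..<4]] @
    [(omitting 5 i @ descending 4 j @ omitting 5 j, 3 # omitting 5 i @ descending 4 j @ omitting 5 (j + 1)).
       i \<leftarrow> [1..<3], j \<leftarrow> [i + 1..<4]] @
    [(omitting 6 i @ omitting 5 i, 5 # omitting 6 i @ omitting 5 (i + 1)). i \<leftarrow> [1..<5]] @
    [(omitting 6 i @ omitting 5 j @ [6], 4 # omitting 6 i @ omitting 5 j). i \<leftarrow> [1..<5], j \<leftarrow> [i + 1..<6]] @
    [(omitting 6 i @ omitting 5 j @ descending 4 k @ omitting 6 k,
      4 # omitting 6 i @ omitting 5 j @ descending 4 k @ omitting 6 (k + 1)).
       i \<leftarrow> [1..<3], j \<leftarrow> [i + 1..<4], k \<leftarrow> [j + 1..<5]]"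

definition last_rules :: "(nat list \<times> nat list) list" where
  "last_rules =
    [(omitting 6 1 @ omitting 5 2 @ descending 4 3 @ [5] @ omitting 6 l @ [5],
      4 # omitting 6 1 @ omitting 5 2 @ descending 4 3 @ [5] @ omitting 6 l). l \<leftarrow> [1..<4]]"

definition e6_rules :: "(nat list \<times> nat list) list" where
  "e6_rules = coxeter_rules @ derived_rules @ last_rules"

abbreviation gens :: "(nat list \<times> nat list) set \<Rightarrow> (letter list \<times> letter list) set" where
  "gens R \<equiv> map_prod (map gen) (map gen) ` R"

lemma xl_eq: "xl i = map gen [i]" and xd_eq: "xd i j = map gen (descending i j)"
  and xo_eq: "xo i j = map gen (omitting i j)"
  by (simp_all add: xl_def xd_def xo_def descending_def omitting_def)

text \<open>Families with one, two or three indices suffice to compare the lists of rules with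
  \<open>R6\<close> and \<open>S6\<close> family by family, leaving only index ranges to
  check.\<close>

lemma rels_gens_comprehension:
  "rels (gens (set [(f i, g i). i \<leftarrow> xs])) = {rel (map gen (f i)) (map gen (g i)) |i. i \<in> set xs}"
  "rels (gens (set [(f' i j, g' i j). i \<leftarrow> xs, j \<leftarrow> ys i])) =
     {rel (map gen (f' i j)) (map gen (g' i j)) |i j. i \<in> set xs \<and> j \<in> set (ys i)}"
  "rels (gens (set [(f'' i j k, g'' i j k). i \<leftarrow> xs, j \<leftarrow> ys i, k \<leftarrow> zs i j])) =
     {rel (map gen (f'' i j k)) (map gen (g'' i j k)) |i j k. i \<in> set xs \<and> j \<in> set (ys i) \<and> k \<in> set (zs i j)}"
  by (simp_all add: image_UN image_image) blast+

lemma R6_eq: "R6 = rels (gens (set coxeter_rules))"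
  unfolding R6_def coxeter_rules_def xl_eq set_append image_Un Un_assoc rels_gens_comprehension
  by (intro arg_cong2[of _ _ _ _ "(\<union>)"] Collect_cong ex_cong1) auto

lemma S6_eq: "S6 = rels (gens (set e6_rules))"
  unfolding S6_def R6_eq e6_rules_def derived_rules_def last_rules_def
    xl_eq xd_eq xo_eq set_append image_Un Un_assoc rels_gens_comprehension
  by (intro arg_cong2[of _ _ _ _ "(\<union>)"] Collect_cong ex_cong1) auto

section \<open>Finite checks on the rules and their transfer to the generators\<close>

text \<open>An executable criterion for a decrease in the deg-lex order. In every rule of
  \<open>e6_rules\<close> that preserves length, the first letters already differ.\<close>

definition admissible :: "nat list \<times> nat list \<Rightarrow> bool" where
  "admissible = (\<lambda>(u, v). list_all (\<lambda>x. 1 \<le> x \<and> x \<le> 6) (u @ v) \<and>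
     (length v < length u \<or> length v = length u \<and> v \<noteq> [] \<and> hd v < hd u))"

lemma admissible_e6_rules: "list_all admissible e6_rules"
  by code_simp

lemma derived_quotients:
  "list_all (\<lambda>(u, v). normalize (rule_table coxeter_rules) [] (u @ rev v) = Some []) derived_rules"
  by code_simp

lemma last_quotients:
  "list_all (\<lambda>(u, v). normalize (rule_table (coxeter_rules @ derived_rules)) [] (u @ rev v) = Some []) last_rules"
  by code_simp

text \<open>The decisive computation: all overlaps and inclusions for all ordered pairs of rules,
  including each rule with itself.\<close>

lemma critical_pairs_join:
  "list_all (joins (rule_table e6_rules)) (concat (map (\<lambda>r. concat (map (critical_pairs r) e6_rules)) e6_rules))"
  by code_simp

lemma inj_on_gen: "inj_on gen {1..6}"
  by (auto simp: inj_on_def gen_inject)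

lemma admissible_less:
  assumes "admissible (u, v)"
  shows "map gen v < map gen u"
proof (cases "length v < length u")
  case True
  then show ?thesis by (cases v; cases u) (auto simp: Cons_less_Cons)
next
  case False
  \<comment> \<open>Together with \<open>y < x\<close> the two bounds put both letters in
    \<open>{1..6}\<close>, where \<open>letter_index\<close> inverts \<open>gen\<close>.\<close>
  with assms obtain x a y b where "u = x # a" "v = y # b" "length a = length b" "y < x" "x \<le> 6" "1 \<le> y"
    by (cases u; cases v) (auto simp: admissible_def)
  then show ?thesis
    by (simp add: Cons_less_Cons less_letter_def gen_inverse)
qed

text \<open>This is applied twice: the Coxeter rules give the derived ones, which then join the
  rewriting rules for the last three.\<close>

lemma quotients_in_ideal:
  assumes base: "rels (gens (set R)) \<subseteq> ideal_generated A"
    and squares: "\<And>x. rel [x, x] [] \<in> ideal_generated A"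
    and quot: "list_all (\<lambda>(u, v). normalize (rule_table R) [] (u @ rev v) = Some []) Q"
  shows "rels (gens (set Q)) \<subseteq> ideal_generated A"
proof -
  have "rel (map gen u) (map gen v) \<in> ideal_generated A" if "(u, v) \<in> set Q" for u v
  proof (rule rel_in_ideal_if_quotient[OF squares])
    have "(rewrite (set R))\<^sup>*\<^sup>* (u @ rev v) []"
      using quot that by (auto simp: list_all_iff intro: normalize_word_sound)
    then show "rel (map gen u @ rev (map gen v)) [] \<in> ideal_generated A"
      using rewrites_in_ideal[OF base rewrites_map] by (force simp: rev_map)
  qed
  then show ?thesis by auto
qed

lemma joinable_gens:
  assumes "r \<in> gens (set e6_rules)" "s \<in> gens (set e6_rules)" "(x, y) \<in> set (critical_pairs r s)"
  shows "joinable (gens (set e6_rules)) x y"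
proof -
  obtain u v p q where r: "(u, v) \<in> set e6_rules" "r = (map gen u, map gen v)"
    and s: "(p, q) \<in> set e6_rules" "s = (map gen p, map gen q)"
    using assms(1,2) by auto
  \<comment> \<open>On these letters \<open>gen\<close> is injective, so each critical pair of the
    images is the image of a critical pair of number words.\<close>
  have "set u \<union> set p \<subseteq> {1..6}"
    using admissible_e6_rules r(1) s(1) by (fastforce simp: list_all_iff admissible_def)
  then have "inj_on gen (set u \<union> set p)"
    by (rule inj_on_subset[OF inj_on_gen])
  then obtain x' y' where xy: "(x', y') \<in> set (critical_pairs (u, v) (p, q))" "x = map gen x'" "y = map gen y'"
    using assms(3) r(2) s(2) by (auto simp: critical_pairs_map simp del: critical_pairs.simps)
  then have "joins (rule_table e6_rules) (x', y')"
    using critical_pairs_join r(1) s(1) by (fastforce simp: list_all_iff simp del: critical_pairs.simps)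
  then show ?thesis
    using xy by (auto intro: joinable_map joins_sound)
qed

theorem theorem3p2:
  shows "ideal_generated (S6 :: (letter, 'k::field) free_algebra set) = ideal_generated R6 \<and>
    groebner_shirshov_basis (S6 :: (letter, 'k) free_algebra set) (ideal_generated R6)"
proof -
  let ?I = "ideal_generated (R6 :: (letter, 'k) free_algebra set)"
  have cox: "rels (gens (set coxeter_rules)) \<subseteq> ?I"
    using ideal_generated_superset by (simp add: R6_eq)
  have squares: "rel [x, x] [] \<in> ?I" for x
  proof -
    obtain i where "x = gen i" "i \<in> {1..6}" by (cases x)
    then have "rel [x, x] [] \<in> (R6 :: (letter, 'k) free_algebra set)"
      \<comment> \<open>The squares form the first family in the union \<open>R6\<close>.\<close>
      unfolding R6_def xl_def by (intro UnI1) auto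
    then show ?thesis using ideal_generated_superset by blast
  qed
  have der: "rels (gens (set derived_rules)) \<subseteq> ?I"
    by (rule quotients_in_ideal[OF cox squares derived_quotients])
  with cox have "rels (gens (set (coxeter_rules @ derived_rules))) \<subseteq> ?I"
    by (simp add: image_Un)
  then have "rels (gens (set last_rules)) \<subseteq> ?I"
    by (rule quotients_in_ideal[OF _ squares last_quotients])
  with cox der have "S6 \<subseteq> ?I"
    by (simp add: S6_eq e6_rules_def image_Un)
  moreover have "R6 \<subseteq> (S6 :: (letter, 'k) free_algebra set)"
    unfolding S6_def by blast
  then have "R6 \<subseteq> ideal_generated (S6 :: (letter, 'k) free_algebra set)"
    using ideal_generated_superset by (rule subset_trans)
  ultimately have eq: "ideal_generated (S6 :: (letter, 'k) free_algebra set) = ?I"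
    by (intro equalityI ideal_generated_minimal)
  have less: "v < u" if "(u, v) \<in> gens (set e6_rules)" for u v
    using that admissible_e6_rules by (auto simp: list_all_iff intro!: admissible_less)
  have "groebner_shirshov_basis (S6 :: (letter, 'k) free_algebra set) (ideal_generated S6)"
    unfolding S6_eq by (rule groebner_shirshov_basis_rels[OF less joinable_gens])
  with eq show ?thesis by simp
qed

end
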